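(* Let $k_1\in\mathbb{N}$, $d\in\mathbb{R}\setminus\{0\}$, $\zeta,\omega,f_0\in\mathbb{R}$, and let $u_0\in H^2_{\mathrm{per}}(0,2\pi)$ be a non-constant non-degenerate solution of $$-d u''+\mathrm{i}\omega u'+(\zeta-\mathrm{i})u-|u|^2u+\mathrm{i}f_0=0,\qquad u\ 2\pi\text{-periodic}.$$ Let $e(s)=\mathrm{e}^{\mathrm{i}k_1s}$ and let $\phi_0^*$ be such that $\ker L_{u_0}^*=\operatorname{span}\{\phi_0^*\}$. Assume that $$\int_0^{2\pi}\mathrm{e}^{\mathrm{i}k_1s}\overline{\phi_0^*(s)}\,ds\neq0$$ and that $\sigma_0\in\mathbb{R}$ satisfies $$\tan(k_1\sigma_0)=\frac{\int_0^{2\pi}\cos(k_1s)\operatorname{Im}\phi_0^*(s)-\sin(k_1s)\operatorname{Re}\phi_0^*(s)\,ds}{\int_0^{2\pi}\sin(k_1s)\operatorname{Im}\phi_0^*(s)+\cos(k_1s)\operatorname{Re}\phi_0^*(s)\,ds}.$$ Then $$\operatorname{Im}\int_0^{2\pi}e(s+\sigma_0)\overline{\phi_0^*(s)}\,ds=0\qquad\text{and}\qquad\operatorname{Im}\int_0^{2\pi}e'(s+\sigma_0)\overline{\phi_0^*(s)}\,ds\neq0.$$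
   Context: All functions are complex valued and function spaces are Hilbert spaces over $\mathbb{R}$; adjoints are taken with respect to $\langle v,w\rangle_2=\operatorname{Re}\int_0^{2\pi}v\overline{w}\,ds$. $H^2_{\mathrm{per}}(0,2\pi)$ is the space of locally square-integrable $2\pi$-periodic functions on $\mathbb{R}$ whose weak derivatives on $\mathbb{R}$ up to order $2$ are locally square-integrable. The $\mathbb{R}$-linear operator $L_u:H^2_{\mathrm{per}}(0,2\pi)\to L^2(0,2\pi)$ is $L_u\varphi=-d\varphi''+\mathrm{i}\omega\varphi'+(\zeta-\mathrm{i}-2|u|^2)\varphi-u^2\overline{\varphi}$; it is Fredholm of index zero. The solution $u_0$ is called non-degenerate if $\ker L_{u_0}=\operatorname{span}_{\mathbb{R}}\{u_0'\}$; then $\ker L_{u_0}^*$ is also one-dimensional and is spanned by some $\phi_0^*\in H^2_{\mathrm{per}}(0,2\pi)$. Convention: if the denominator in the formula for $\tan(k_1\sigma_0)$ vanishes, the formula is to be read as $\cos(k_1\sigma_0)=0$ (the numerator and denominator do not vanish simultaneously by the first assumption). *)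

theory Defs
  imports "HOL-Analysis.Analysis"
begin

text \<open>Functions are handled as representatives \<open>real \<Rightarrow> complex\<close> of almost-everywhere
  classes; every notion below is invariant under changes on null sets.\<close>

abbreviation period_measure :: "real measure" where
  "period_measure \<equiv> lebesgue_on {0<..<2 * pi}"

definition L2_loc :: "(real \<Rightarrow> complex) set" where
  "L2_loc = {f. f \<in> borel_measurable lebesgue \<and>
     (\<forall>a b. integrable (lebesgue_on {a..b}) (\<lambda>x. (norm (f x))\<^sup>2))}"

definition L2_period :: "(real \<Rightarrow> complex) set" where
  "L2_period = {f. f \<in> borel_measurable period_measure \<and>
     integrable period_measure (\<lambda>x. (norm (f x))\<^sup>2)}"

definition inner2 :: "(real \<Rightarrow> complex) \<Rightarrow> (real \<Rightarrow> complex) \<Rightarrow> real" where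
  "inner2 v w = Re (LINT s|period_measure. v s * cnj (w s))"

definition test_functions :: "(real \<Rightarrow> real) set" where
  "test_functions = {\<eta>. (\<forall>n x. (deriv ^^ n) \<eta> field_differentiable at x) \<and>
     compact (closure {x. \<eta> x \<noteq> 0})}"

definition has_weak_deriv :: "(real \<Rightarrow> complex) \<Rightarrow> (real \<Rightarrow> complex) \<Rightarrow> bool" where
  "has_weak_deriv f g \<longleftrightarrow> f \<in> L2_loc \<and> g \<in> L2_loc \<and>
     (\<forall>\<eta>\<in>test_functions.
        (LINT x|lebesgue. deriv \<eta> x *\<^sub>R f x) = - (LINT x|lebesgue. \<eta> x *\<^sub>R g x))"

text \<open>A weak derivative is unique only up to null sets; \<open>weak_deriv\<close> selects a representative.\<close>

definition weak_deriv :: "(real \<Rightarrow> complex) \<Rightarrow> real \<Rightarrow> complex" where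
  "weak_deriv f = (SOME g. has_weak_deriv f g)"

definition H2_per :: "(real \<Rightarrow> complex) set" where
  "H2_per = {f. f \<in> L2_loc \<and> (AE x in lebesgue. f (x + 2 * pi) = f x) \<and>
     (\<exists>f1 f2. has_weak_deriv f f1 \<and> has_weak_deriv f1 f2)}"

definition is_solution ::
  "real \<Rightarrow> real \<Rightarrow> real \<Rightarrow> real \<Rightarrow> (real \<Rightarrow> complex) \<Rightarrow> bool" where
  "is_solution d \<omega> \<zeta> f0 u \<longleftrightarrow> u \<in> H2_per \<and>
     (AE s in lebesgue.
        - of_real d * weak_deriv (weak_deriv u) s + \<i> * of_real \<omega> * weak_deriv u s
        + (of_real \<zeta> - \<i>) * u s - of_real ((cmod (u s))\<^sup>2) * u s + \<i> * of_real f0 = 0)"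

definition lin_op ::
  "real \<Rightarrow> real \<Rightarrow> real \<Rightarrow> (real \<Rightarrow> complex) \<Rightarrow> (real \<Rightarrow> complex) \<Rightarrow> real \<Rightarrow> complex" where
  "lin_op d \<omega> \<zeta> u \<phi> = (\<lambda>s.
     - of_real d * weak_deriv (weak_deriv \<phi>) s + \<i> * of_real \<omega> * weak_deriv \<phi> s
     + (of_real \<zeta> - \<i> - 2 * of_real ((cmod (u s))\<^sup>2)) * \<phi> s - (u s)\<^sup>2 * cnj (\<phi> s))"

text \<open>The span over the reals of one almost-everywhere class, as the set of all representatives.\<close>

definition ae_span :: "real measure \<Rightarrow> (real \<Rightarrow> complex) \<Rightarrow> (real \<Rightarrow> complex) set" where
  "ae_span M f = {g. \<exists>c::real. AE x in M. g x = c *\<^sub>R f x}"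

definition lin_op_kernel ::
  "real \<Rightarrow> real \<Rightarrow> real \<Rightarrow> (real \<Rightarrow> complex) \<Rightarrow> (real \<Rightarrow> complex) set" where
  "lin_op_kernel d \<omega> \<zeta> u =
     {\<phi> \<in> H2_per. AE s in period_measure. lin_op d \<omega> \<zeta> u \<phi> s = 0}"

definition nondegenerate ::
  "real \<Rightarrow> real \<Rightarrow> real \<Rightarrow> (real \<Rightarrow> complex) \<Rightarrow> bool" where
  "nondegenerate d \<omega> \<zeta> u \<longleftrightarrow> lin_op_kernel d \<omega> \<zeta> u = ae_span lebesgue (weak_deriv u)"

text \<open>Graph of the adjoint, with respect to \<open>inner2\<close>, of an operator \<open>T\<close> with domain \<open>D\<close>.\<close>

definition adjoint_graph ::
  "((real \<Rightarrow> complex) \<Rightarrow> real \<Rightarrow> complex) \<Rightarrow> (real \<Rightarrow> complex) set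
     \<Rightarrow> ((real \<Rightarrow> complex) \<times> (real \<Rightarrow> complex)) set" where
  "adjoint_graph T D = {(w, z). w \<in> L2_period \<and> z \<in> L2_period \<and>
     (\<forall>v\<in>D. inner2 (T v) w = inner2 v z)}"

definition lin_op_adjoint_kernel ::
  "real \<Rightarrow> real \<Rightarrow> real \<Rightarrow> (real \<Rightarrow> complex) \<Rightarrow> (real \<Rightarrow> complex) set" where
  "lin_op_adjoint_kernel d \<omega> \<zeta> u =
     {\<phi>. (\<phi>, \<lambda>_. 0) \<in> adjoint_graph (lin_op d \<omega> \<zeta> u) H2_per}"

text \<open>The equation \<open>tan x = a / b\<close> in the sense of the projective line for \<open>b = 0\<close>.
  The condition \<open>cos x \<noteq> 0\<close> is needed because HOL sets \<open>tan x = 0\<close> where \<open>cos x = 0\<close>.\<close>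

definition tan_eq_quotient :: "real \<Rightarrow> real \<Rightarrow> real \<Rightarrow> bool" where
  "tan_eq_quotient x a b \<longleftrightarrow>
     (if b = 0 then cos x = 0 else cos x \<noteq> 0 \<and> tan x = a / b)"

end

theory Submission
  imports Defs
begin

text \<open>
  Write \<open>I\<close> for the pairing \<open>\<integral> exp (\<i> k s) * cnj (\<phi> s)\<close> over one period. A shift of the
  forcing by \<open>\<sigma>\<close> multiplies it by the unimodular factor \<open>cis (k * \<sigma>)\<close>, and a derivative of the
  forcing multiplies it by \<open>\<i> * k\<close>. So the two claims concern the single complex number
  \<open>z = cis (k * \<sigma>) * I\<close>: they say \<open>Im z = 0\<close> and \<open>k * Re z \<noteq> 0\<close>. The second follows from the first,
  because \<open>I \<noteq> 0\<close> gives \<open>z \<noteq> 0\<close> and \<open>k\<close> is positive. The first is the tangent condition: its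
  denominator and numerator are \<open>Re I\<close> and \<open>- Im I\<close>, so \<open>k * \<sigma>\<close> is minus the argument of \<open>I\<close> modulo \<open>\<pi>\<close>, and the rotation by
  \<open>k * \<sigma>\<close> takes \<open>I\<close> to the real axis (lemma \<open>Im_cis_mult_eq_0_of_tan\<close>).

  The integrand of \<open>I\<close> is integrable because \<open>I \<noteq> 0\<close>: the integral of a non-integrable
  function has the value \<open>0\<close>. This justifies the separation of real and imaginary parts.
\<close>

text \<open>The imaginary part is \<open>sin x * Re I + cos x * Im I\<close>. Its vanishing is the tangent condition
  with the denominators \<open>cos x\<close> and \<open>Re I\<close> cleared; for \<open>Re I = 0\<close> it follows from the convention
  \<open>cos x = 0\<close>.\<close>

lemma Im_cis_mult_eq_0_of_tan:
  fixes I :: complex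
  assumes "tan_eq_quotient x (- Im I) (Re I)"
  shows "Im (cis x * I) = 0"
  using assms by (auto simp: tan_eq_quotient_def tan_def field_simps split: if_splits)

lemma Im_i_mult_cis_mult_neq_0:
  fixes I :: complex
  assumes "I \<noteq> 0" and "k \<noteq> 0" and "Im (cis x * I) = 0"
  shows "Im (\<i> * of_nat k * (cis x * I)) \<noteq> 0"
proof -
  have "cis x * I \<noteq> 0"
    using assms(1) by simp
  then have "Re (cis x * I) \<noteq> 0"
    using assms(3) by (metis complex_eq_iff zero_complex.sel)
  moreover have "Im (\<i> * of_nat k * z) = real k * Re z" for z
    by simp
  ultimately show ?thesis
    using assms(2) by (metis mult_eq_0_iff of_nat_eq_0_iff)
qed

lemma exp_ii_mult: "exp (\<i> * of_nat k * of_real s) = cis (real k * s)"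
  by (simp add: cis_conv_exp mult.assoc)

lemma vector_derivative_exp_ii_mult:
  "vector_derivative (\<lambda>s. exp (\<i> * of_nat k * of_real s)) (at t)
    = \<i> * of_nat k * exp (\<i> * of_nat k * of_real t)"
proof (rule vector_derivative_at)
  have "((\<lambda>z. exp (\<i> * of_nat k * z)) has_field_derivative
      \<i> * of_nat k * exp (\<i> * of_nat k * of_real t)) (at (of_real t))"
    by (auto intro!: derivative_eq_intros)
  then show "((\<lambda>s. exp (\<i> * of_nat k * of_real s)) has_vector_derivative
      \<i> * of_nat k * exp (\<i> * of_nat k * of_real t)) (at t)"
    by (rule has_vector_derivative_real_field)
qed

theorem corollary10:
  fixes k1 :: nat and d \<zeta> \<omega> f0 \<sigma>0 :: real
    and u0 \<phi>0 e :: "real \<Rightarrow> complex"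
  assumes "k1 \<ge> 1" and "d \<noteq> 0"
    and "is_solution d \<omega> \<zeta> f0 u0"
    and "\<not> (\<exists>c. AE s in lebesgue. u0 s = c)"
    and "nondegenerate d \<omega> \<zeta> u0"
    and "e = (\<lambda>s. exp (\<i> * of_nat k1 * of_real s))"
    and "lin_op_adjoint_kernel d \<omega> \<zeta> u0 = ae_span period_measure \<phi>0"
    and "(LINT s|period_measure. exp (\<i> * of_nat k1 * of_real s) * cnj (\<phi>0 s)) \<noteq> 0"
    and "tan_eq_quotient (real k1 * \<sigma>0)
      (LINT s|period_measure. cos (real k1 * s) * Im (\<phi>0 s) - sin (real k1 * s) * Re (\<phi>0 s))
      (LINT s|period_measure. sin (real k1 * s) * Im (\<phi>0 s) + cos (real k1 * s) * Re (\<phi>0 s))"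
  shows "Im (LINT s|period_measure. e (s + \<sigma>0) * cnj (\<phi>0 s)) = 0 \<and>
    Im (LINT s|period_measure. vector_derivative e (at (s + \<sigma>0)) * cnj (\<phi>0 s)) \<noteq> 0"
proof -
  define g where "g s = cis (real k1 * s) * cnj (\<phi>0 s)" for s
  define I where "I = (LINT s|period_measure. g s)"
  have I_neq_0: "I \<noteq> 0"
    using assms(8) by (simp add: I_def g_def exp_ii_mult)
  then have g_integrable: "integrable period_measure g"
    unfolding I_def using not_integrable_integral_eq by blast
  have denominator: "(LINT s|period_measure.
      sin (real k1 * s) * Im (\<phi>0 s) + cos (real k1 * s) * Re (\<phi>0 s)) = Re I"
    unfolding I_def integral_Re[OF g_integrable, symmetric] by (simp add: g_def add.commute)
  have "(LINT s|period_measure.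
      cos (real k1 * s) * Im (\<phi>0 s) - sin (real k1 * s) * Re (\<phi>0 s))
      = (LINT s|period_measure. - Im (g s))"
    by (simp add: g_def)
  also have "\<dots> = - Im I"
    by (simp add: I_def integral_Im[OF g_integrable])
  finally have numerator: "(LINT s|period_measure.
      cos (real k1 * s) * Im (\<phi>0 s) - sin (real k1 * s) * Re (\<phi>0 s)) = - Im I" .
  have shifted_real: "Im (cis (real k1 * \<sigma>0) * I) = 0"
    using assms(9) unfolding numerator denominator by (rule Im_cis_mult_eq_0_of_tan)
  have shift: "e (s + \<sigma>0) * cnj (\<phi>0 s) = cis (real k1 * \<sigma>0) * g s" for s
    unfolding assms(6) exp_ii_mult g_def by (simp add: cis_mult[symmetric] distrib_left)
  have shift_deriv: "vector_derivative e (at (s + \<sigma>0)) * cnj (\<phi>0 s)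
      = \<i> * of_nat k1 * cis (real k1 * \<sigma>0) * g s" for s
    using shift[of s] unfolding assms(6) vector_derivative_exp_ii_mult
    by (simp add: mult.assoc)
  have "Im (LINT s|period_measure. e (s + \<sigma>0) * cnj (\<phi>0 s)) = 0"
    using shifted_real unfolding shift integral_mult_right_zero I_def .
  moreover have "Im (\<i> * of_nat k1 * (cis (real k1 * \<sigma>0) * I)) \<noteq> 0"
    using I_neq_0 assms(1) shifted_real by (intro Im_i_mult_cis_mult_neq_0) auto
  then have "Im (LINT s|period_measure. vector_derivative e (at (s + \<sigma>0)) * cnj (\<phi>0 s)) \<noteq> 0"
    unfolding shift_deriv integral_mult_right_zero I_def by (simp only: mult.assoc not_False_eq_True)
  ultimately show ?thesis
    by blast
qed

end
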